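(* Let $E:\mathbb{R}^n\to\mathbb{R}^n$ be one-to-one and onto, let $\eta:\mathbb{R}^n\times\mathbb{R}^n\to\mathbb{R}^n$, and consider the multiobjective problem (VP) of minimizing $f=(f_1,\dots,f_p)$ subject to $g_k(x)\leq 0$ ($k\in K$) and $h_j(x)=0$ ($j\in J$), with all functions $\mathbb{R}^n\to\mathbb{R}$ and $E$-differentiable on $\mathbb{R}^n$, with feasible set $\Omega$, and with $\Omega_E=\{x\in\mathbb{R}^n: E(x)\in\Omega\}$. Let $(E(\overline{y}),\overline{\tau},\overline{\rho},\overline{\xi})\in\Omega\times\mathbb{R}^p\times\mathbb{R}^m\times\mathbb{R}^q$ be an $E$-Karush-Kuhn-Tucker point of (VP). Let $K(E(\overline{y}))=\{k\in K: g_k(E(\overline{y}))=0\}$, $J^+(E(\overline{y}))=\{j\in J:\overline{\xi}_j>0\}$ and $J^-(E(\overline{y}))=\{j\in J:\overline{\xi}_j<0\}$. Assume that, with respect to the map $\eta$: (a) each $f_i$, $i\in I$, is exponentially strictly $E$-invex at $\overline{y}$ on $\Omega_E$; (b) each $g_k$, $k\in K(E(\overline{y}))$, is exponentially $E$-invex at $\overline{y}$ on $\Omega_E$; (c) each $h_j$, $j\in J^+(E(\overline{y}))$, is exponentially $E$-invex at $\overline{y}$ on $\Omega_E$; (d) each $-h_j$, $j\in J^-(E(\overline{y}))$, is exponentially $E$-invex at $\overline{y}$ on $\Omega_E$. Then $E(\overline{y})$ is an $E$-Pareto solution of (VP).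
   Context: Index sets: $I=\{1,\dots,p\}$, $K=\{1,\dots,m\}$, $J=\{1,\dots,q\}$. The feasible set is $\Omega=\{x\in\mathbb{R}^n: g_k(x)\leq 0\ (k\in K),\ h_j(x)=0\ (j\in J)\}$. A function $\phi:\mathbb{R}^n\to\mathbb{R}$ is $E$-differentiable at $x_0$ if $\phi\circ E$ is differentiable at $x_0$ in the usual sense. Gradients are row vectors, so the product with a vector of $\mathbb{R}^n$ is the inner product. $(E(\overline{y}),\overline{\tau},\overline{\rho},\overline{\xi})\in\Omega\times\mathbb{R}^p\times\mathbb{R}^m\times\mathbb{R}^q$ is an $E$-Karush-Kuhn-Tucker point of (VP) if $$\sum_{i=1}^p\overline{\tau}_i\nabla(f_i\circ E)(\overline{y})+\sum_{k=1}^m\overline{\rho}_k\nabla(g_k\circ E)(\overline{y})+\sum_{j=1}^q\overline{\xi}_j\nabla(h_j\circ E)(\overline{y})=0,$$ $\overline{\rho}_k\,g_k(E(\overline{y}))=0$ for all $k\in K$, $\overline{\tau}_i\geq 0$ for all $i\in I$ with $\overline{\tau}\neq 0$, and $\overline{\rho}_k\geq0$ for all $k\in K$. An $E$-differentiable function $\phi$ is exponentially $E$-invex at $\overline{y}$ on $\Omega_E$ (with respect to $\eta$) if for all $x\in\Omega_E$, $$e^{\phi(E(x))}-e^{\phi(E(\overline{y}))}\geq\nabla(\phi\circ E)(\overline{y})\,e^{\phi(E(\overline{y}))}\,\eta(E(x),E(\overline{y})).$$ It is exponentially strictly $E$-invex at $\overline{y}$ on $\Omega_E$ (with respect to $\eta$)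 if this inequality holds with $>$ for all $x\in\Omega_E$ with $x\neq\overline{y}$. A point $E(\overline{y})\in\Omega$ is an $E$-Pareto solution of (VP) if there is no $E(x)\in\Omega$ with $f_i(E(x))\leq f_i(E(\overline{y}))$ for all $i\in I$ and $f(E(x))\neq f(E(\overline{y}))$. *)

theory Defs
  imports "HOL-Analysis.Analysis"
begin

(* The unique D with GDERIV f x :> D; meaningful only where f is differentiable. *)
definition gradient :: "('a::real_inner \<Rightarrow> real) \<Rightarrow> 'a \<Rightarrow> 'a"
  where "gradient f x = (THE D. GDERIV f x :> D)"

lemma gradient_unique:
  assumes "GDERIV f x :> D"
  shows "gradient f x = D"
  unfolding gradient_def
proof (rule the_equality)
  show "GDERIV f x :> D" by fact
next
  fix D' assume "GDERIV f x :> D'"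
  with assms have "(\<lambda>h. inner h D') = (\<lambda>h. inner h D)"
    unfolding gderiv_def by (rule has_derivative_unique[rotated])
  then have "inner (D' - D) D' = inner (D' - D) D" by metis
  then have "inner (D' - D) (D' - D) = 0" by (simp add: inner_diff_right)
  then show "D' = D" by simp
qed

lemma gradient_works:
  fixes f :: "'a::euclidean_space \<Rightarrow> real"
  assumes "f differentiable (at x)"
  shows "GDERIV f x :> gradient f x"
proof -
  obtain f' where f': "(f has_derivative f') (at x)"
    using assms unfolding differentiable_def by blast
  interpret linear f' using f' by (rule has_derivative_linear)
  have "f' = (\<lambda>h. inner h (\<Sum>b\<in>Basis. f' b *\<^sub>R b))"
  proof
    fix h
    have "f' h = f' (\<Sum>b\<in>Basis. inner h b *\<^sub>R b)" by (simp add: euclidean_representation)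
    also have "\<dots> = (\<Sum>b\<in>Basis. inner h b * f' b)" by (simp add: sum scale)
    also have "\<dots> = inner h (\<Sum>b\<in>Basis. f' b *\<^sub>R b)"
      by (simp add: inner_sum_right mult.commute)
    finally show "f' h = inner h (\<Sum>b\<in>Basis. f' b *\<^sub>R b)" .
  qed
  then have "GDERIV f x :> (\<Sum>b\<in>Basis. f' b *\<^sub>R b)"
    using f' unfolding gderiv_def by simp
  then show ?thesis using gradient_unique by metis
qed

definition E_differentiable_at :: "('a::real_inner \<Rightarrow> 'a) \<Rightarrow> ('a \<Rightarrow> real) \<Rightarrow> 'a \<Rightarrow> bool"
  where "E_differentiable_at E \<phi> x \<longleftrightarrow> (\<phi> \<circ> E) differentiable (at x)"

(* Families of objectives, inequality and equality constraints are indexed by {1..p}, {1..m} and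
   {1..q}; their members at other indices, and the multipliers there, never enter. *)

definition feasible_set ::
    "nat \<Rightarrow> (nat \<Rightarrow> 'a \<Rightarrow> real) \<Rightarrow> nat \<Rightarrow> (nat \<Rightarrow> 'a \<Rightarrow> real) \<Rightarrow> 'a set"
  where "feasible_set m g q h = {x. (\<forall>k\<in>{1..m}. g k x \<le> 0) \<and> (\<forall>j\<in>{1..q}. h j x = 0)}"

(* The conditions are on the tuple (E y, \<tau>, \<rho>, \<xi>), with y itself as the argument. *)
definition E_KKT_point ::
    "('a::real_inner \<Rightarrow> 'a) \<Rightarrow> nat \<Rightarrow> (nat \<Rightarrow> 'a \<Rightarrow> real) \<Rightarrow> nat \<Rightarrow> (nat \<Rightarrow> 'a \<Rightarrow> real) \<Rightarrow>
     nat \<Rightarrow> (nat \<Rightarrow> 'a \<Rightarrow> real) \<Rightarrow> 'a \<Rightarrow> (nat \<Rightarrow> real) \<Rightarrow> (nat \<Rightarrow> real) \<Rightarrow> (nat \<Rightarrow> real) \<Rightarrow> bool"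
  where "E_KKT_point E p f m g q h y \<tau> \<rho> \<xi> \<longleftrightarrow>
    E y \<in> feasible_set m g q h \<and>
    (\<Sum>i\<in>{1..p}. \<tau> i *\<^sub>R gradient (f i \<circ> E) y) +
      (\<Sum>k\<in>{1..m}. \<rho> k *\<^sub>R gradient (g k \<circ> E) y) +
      (\<Sum>j\<in>{1..q}. \<xi> j *\<^sub>R gradient (h j \<circ> E) y) = 0 \<and>
    (\<forall>k\<in>{1..m}. \<rho> k * g k (E y) = 0) \<and>
    (\<forall>i\<in>{1..p}. \<tau> i \<ge> 0) \<and> (\<exists>i\<in>{1..p}. \<tau> i \<noteq> 0) \<and>
    (\<forall>k\<in>{1..m}. \<rho> k \<ge> 0)"

definition exp_E_invex_at ::
    "('a::real_inner \<Rightarrow> 'a) \<Rightarrow> ('a \<Rightarrow> 'a \<Rightarrow> 'a) \<Rightarrow> 'a set \<Rightarrow> ('a \<Rightarrow> real) \<Rightarrow> 'a \<Rightarrow> bool"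
  where "exp_E_invex_at E \<eta> S \<phi> y \<longleftrightarrow>
    (\<forall>x. E_differentiable_at E \<phi> x) \<and>
    (\<forall>x\<in>S. exp (\<phi> (E x)) - exp (\<phi> (E y)) \<ge>
      inner (exp (\<phi> (E y)) *\<^sub>R gradient (\<phi> \<circ> E) y) (\<eta> (E x) (E y)))"

definition exp_strictly_E_invex_at ::
    "('a::real_inner \<Rightarrow> 'a) \<Rightarrow> ('a \<Rightarrow> 'a \<Rightarrow> 'a) \<Rightarrow> 'a set \<Rightarrow> ('a \<Rightarrow> real) \<Rightarrow> 'a \<Rightarrow> bool"
  where "exp_strictly_E_invex_at E \<eta> S \<phi> y \<longleftrightarrow>
    (\<forall>x. E_differentiable_at E \<phi> x) \<and>
    (\<forall>x\<in>S. x \<noteq> y \<longrightarrow> exp (\<phi> (E x)) - exp (\<phi> (E y)) >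
      inner (exp (\<phi> (E y)) *\<^sub>R gradient (\<phi> \<circ> E) y) (\<eta> (E x) (E y)))"

(* The property is that of the point E y, with y itself as the argument; \<Omega> is the feasible set. *)
definition E_Pareto_solution ::
    "('a \<Rightarrow> 'a) \<Rightarrow> nat \<Rightarrow> (nat \<Rightarrow> 'a \<Rightarrow> real) \<Rightarrow> 'a set \<Rightarrow> 'a \<Rightarrow> bool"
  where "E_Pareto_solution E p f \<Omega> y \<longleftrightarrow>
    E y \<in> \<Omega> \<and>
    \<not> (\<exists>x. E x \<in> \<Omega> \<and> (\<forall>i\<in>{1..p}. f i (E x) \<le> f i (E y)) \<and>
        (\<exists>i\<in>{1..p}. f i (E x) \<noteq> f i (E y)))"

end

theory Submission
  imports Defs
begin

text \<open>Suppose a feasible \<open>E x\<close> dominates \<open>E y\<close>, and pair the stationarity equation with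
  \<open>\<eta> (E x) (E y)\<close>. Since no objective and no active constraint increases from \<open>E y\<close> to \<open>E x\<close>,
  exponential invexity makes every term nonpositive. Strictness makes the term of an objective with
  positive multiplier negative, so the sum cannot vanish.\<close>

text \<open>The exponentials enter only through sign: \<open>exp\<close> is increasing, so the
  difference of exponentials is nonpositive, and the positive factor
  \<open>exp (\<phi> (E y))\<close> can be divided out of the inner product.\<close>

lemma exp_E_invex_at_descent:
  assumes "exp_E_invex_at E \<eta> S \<phi> y" and "x \<in> S" and "\<phi> (E x) \<le> \<phi> (E y)"
  shows "inner (gradient (\<phi> \<circ> E) y) (\<eta> (E x) (E y)) \<le> 0"
proof -
  have "exp (\<phi> (E y)) * inner (gradient (\<phi> \<circ> E) y) (\<eta> (E x) (E y)) \<le> exp (\<phi> (E x)) - exp (\<phi> (E y))"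
    using assms by (simp add: exp_E_invex_at_def)
  also have "\<dots> \<le> 0"
    using assms by simp
  finally show ?thesis
    by (simp add: mult_le_0_iff)
qed

lemma exp_strictly_E_invex_at_descent:
  assumes "exp_strictly_E_invex_at E \<eta> S \<phi> y" and "x \<in> S" and "x \<noteq> y" and "\<phi> (E x) \<le> \<phi> (E y)"
  shows "inner (gradient (\<phi> \<circ> E) y) (\<eta> (E x) (E y)) < 0"
proof -
  have "exp (\<phi> (E y)) * inner (gradient (\<phi> \<circ> E) y) (\<eta> (E x) (E y)) < exp (\<phi> (E x)) - exp (\<phi> (E y))"
    using assms by (simp add: exp_strictly_E_invex_at_def)
  also have "\<dots> \<le> 0"
    using assms by simp
  finally show ?thesis
    by (simp add: mult_less_0_iff)
qed

text \<open>Turns invexity of \<open>- h j\<close>, assumed where \<open>\<xi> j < 0\<close>, into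
  information on the gradient of \<open>h j \<circ> E\<close>. Differentiability ensures that the
  description defining \<open>gradient\<close> denotes.\<close>

lemma gradient_uminus:
  fixes \<phi> :: "'a::euclidean_space \<Rightarrow> real"
  assumes "\<phi> differentiable (at x)"
  shows "gradient (\<lambda>z. - \<phi> z) x = - gradient \<phi> x"
  by (intro gradient_unique GDERIV_minus gradient_works assms)

theorem theorem28:
  fixes E :: "real ^ 'n \<Rightarrow> real ^ 'n"
    and \<eta> :: "real ^ 'n \<Rightarrow> real ^ 'n \<Rightarrow> real ^ 'n"
    and p m q :: nat
    and f g h :: "nat \<Rightarrow> real ^ 'n \<Rightarrow> real"
    and \<Omega> \<Omega>\<^sub>E :: "(real ^ 'n) set"
    and y :: "real ^ 'n"
    and \<tau> \<rho> \<xi> :: "nat \<Rightarrow> real"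
  defines "\<Omega> \<equiv> feasible_set m g q h"
    and "\<Omega>\<^sub>E \<equiv> {x. E x \<in> \<Omega>}"
  assumes "bij E"
    and "\<forall>i\<in>{1..p}. \<forall>x. E_differentiable_at E (f i) x"
    and "\<forall>k\<in>{1..m}. \<forall>x. E_differentiable_at E (g k) x"
    and "\<forall>j\<in>{1..q}. \<forall>x. E_differentiable_at E (h j) x"
    and "E_KKT_point E p f m g q h y \<tau> \<rho> \<xi>"
    and "\<forall>i\<in>{1..p}. exp_strictly_E_invex_at E \<eta> \<Omega>\<^sub>E (f i) y"
    and "\<forall>k\<in>{k\<in>{1..m}. g k (E y) = 0}. exp_E_invex_at E \<eta> \<Omega>\<^sub>E (g k) y"
    and "\<forall>j\<in>{j\<in>{1..q}. \<xi> j > 0}. exp_E_invex_at E \<eta> \<Omega>\<^sub>E (h j) y"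
    and "\<forall>j\<in>{j\<in>{1..q}. \<xi> j < 0}. exp_E_invex_at E \<eta> \<Omega>\<^sub>E (\<lambda>x. - h j x) y"
  shows "E_Pareto_solution E p f \<Omega> y"
proof -
  let ?v = "\<lambda>x. \<eta> (E x) (E y)"
  let ?d = "\<lambda>\<phi> x. inner (gradient (\<phi> \<circ> E) y) (?v x)"
  note kkt = \<open>E_KKT_point E p f m g q h y \<tau> \<rho> \<xi>\<close>[unfolded E_KKT_point_def]
  have feas_y: "E y \<in> \<Omega>"
    using kkt by (simp add: \<Omega>_def)
  have False
    if feas_x: "E x \<in> \<Omega>" and le: "\<forall>i\<in>{1..p}. f i (E x) \<le> f i (E y)"
      and ne: "\<exists>i\<in>{1..p}. f i (E x) \<noteq> f i (E y)" for x
  proof -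
    \<comment> \<open>Some objective differs between \<open>E x\<close> and \<open>E y\<close>, so
      \<open>x\<close> cannot be \<open>y\<close>; the strict inequality is available only away from
      \<open>y\<close>.\<close>
    have x: "x \<in> \<Omega>\<^sub>E" "x \<noteq> y"
      using feas_x ne by (auto simp: \<Omega>\<^sub>E_def)
    have f: "?d (f i) x < 0" if "i \<in> {1..p}" for i
      using that assms x le by (blast intro: exp_strictly_E_invex_at_descent)
    have g: "\<rho> k * ?d (g k) x \<le> 0" if k: "k \<in> {1..m}" for k
    \<comment> \<open>An active constraint cannot increase, since \<open>E x\<close> is feasible;
      for an inactive one complementarity forces \<open>\<rho> k = 0\<close>.\<close>
    proof (cases "g k (E y) = 0")
      case True
      moreover have "g k (E x) \<le> 0"
        using feas_x k by (simp add: \<Omega>_def feasible_set_def)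
      ultimately have "?d (g k) x \<le> 0"
        using assms k x by (intro exp_E_invex_at_descent) auto
      then show ?thesis
        using kkt k by (simp add: mult_nonneg_nonpos)
    next
      case False
      then show ?thesis
        using kkt k by (metis mult_eq_0_iff order_refl)
    qed
    have h: "\<xi> j * ?d (h j) x \<le> 0" if j: "j \<in> {1..q}" for j
    proof -
      \<comment> \<open>Both values are 0 by feasibility, so the descent lemma applies to
        \<open>h j\<close> and to \<open>- h j\<close> alike.\<close>
      have eq: "h j (E x) = h j (E y)"
        using feas_x feas_y j by (simp add: \<Omega>_def feasible_set_def)
      consider "\<xi> j = 0" | "\<xi> j > 0" | "\<xi> j < 0"
        by linarith
      then show ?thesis
      proof cases
        case 1
        then show ?thesis by simp
      next
        case 2
        then have "?d (h j) x \<le> 0"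
          using assms j x eq by (intro exp_E_invex_at_descent) auto
        with 2 show ?thesis
          by (simp add: mult_nonneg_nonpos)
      next
        case 3
        then have "?d (\<lambda>z. - h j z) x \<le> 0"
          using assms j x eq by (intro exp_E_invex_at_descent) auto
        \<comment> \<open>The sign flip makes the product for \<open>h j\<close> nonnegative, and
          the negative \<open>\<xi> j\<close> turns it back to nonpositive.\<close>
        moreover have "gradient ((\<lambda>z. - h j z) \<circ> E) y = - gradient (h j \<circ> E) y"
          using assms j gradient_uminus[of "h j \<circ> E" y]
          by (simp add: E_differentiable_at_def o_def)
        ultimately have "?d (h j) x \<ge> 0"
          by simp
        with 3 show ?thesis
          by (simp add: mult_nonpos_nonneg)
      qed
    qed
    \<comment> \<open>A nonzero multiplier exists and all are nonnegative, so one is positive; it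
      makes the objective sum strictly negative.\<close>
    obtain i where i: "i \<in> {1..p}" "\<tau> i > 0"
      using kkt by (metis order_le_less)
    have "(\<Sum>i\<in>{1..p}. \<tau> i * ?d (f i) x) < (\<Sum>i\<in>{1..p}. 0)"
    proof (rule sum_strict_mono_ex1)
      show "\<forall>i\<in>{1..p}. \<tau> i * ?d (f i) x \<le> 0"
        using kkt f by (blast intro: mult_nonneg_nonpos less_imp_le)
      show "\<exists>i\<in>{1..p}. \<tau> i * ?d (f i) x < 0"
        using i f by (blast intro: mult_pos_neg)
    qed simp
    moreover have "(\<Sum>k\<in>{1..m}. \<rho> k * ?d (g k) x) \<le> 0"
      using g by (rule sum_nonpos)
    moreover have "(\<Sum>j\<in>{1..q}. \<xi> j * ?d (h j) x) \<le> 0"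
      using h by (rule sum_nonpos)
    moreover have "(\<Sum>i\<in>{1..p}. \<tau> i * ?d (f i) x) + (\<Sum>k\<in>{1..m}. \<rho> k * ?d (g k) x) +
        (\<Sum>j\<in>{1..q}. \<xi> j * ?d (h j) x) = 0"
      using arg_cong[OF conjunct1[OF conjunct2[OF kkt]], of "\<lambda>u. inner u (?v x)"]
      by (simp add: inner_add_left inner_sum_left)
    ultimately show False
      by simp
  qed
  with feas_y show ?thesis
    unfolding E_Pareto_solution_def by blast
qed

end
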